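(* Let $n\ge 3$ be an integer and let ${}_{i}f_{j}$ and ${}_{r}g_{s}$ be two distinct, nontrivial linear groupoid identities of length $2n$. Then ${}_{i}f_{j}$ implies ${}_{r}g_{s}$ if and only if $i=j=r=s$ and $g=f^k$ for some $k\ne 0$.
   Context: A groupoid is a set with one binary operation. A groupoid identity $u=v$ is linear of length $2n$ if the same $n$ variables occur in both terms $u$ and $v$, each exactly once on each side. A bracketing of length $n$ is an unlabelled (ordered, full) binary tree with $n$ leaves, i.e. a way of parenthesizing a product of $n$ factors. There are $C_n$ of them, where $C_1=C_2=1$, $C_n=\sum_{k=1}^{n-1}C_kC_{n-k}$. Bracketings of length $n$ are labelled bijectively by $0,\dots,C_n-1$ as follows: the bracketing $t$ of length 1 has $b(t)=0$; if $t=t_\lambda t_\rho$ has length $n>1$ with $t_\rho$ of length $m$ and $t_\lambda$ of length $n-m$, then $b(t)=\left(\sum_{k=1}^{m-1}C_kC_{n-k}\right)+b(t_\rho)C_{n-m}+b(t_\lambda)$. The linear identity $u=v$ of length $2n$ is denoted ${}_{i}f_{j}$, where $i=b(u)$ and $j=b(v)$ are the labels of the bracketings of $u$ and $v$, and $f\in S_n$ is the permutation reordering the variables of $u$ into the order they have in $v$: the variable in position $p$ of $u$ is in position $f(p)$ of $v$. (Example: $((xy)u)v=(xu)(vy)$ is ${}_{0}f_{2}$ with $f=(2,4,3)$.) Renaming of variables is disregarded, and an identity is considered the same as the one obtained by interchanging its sides, i.e. ${}_{i}f_{j}$ and ${}_{j}(f^{-1})_{i}$ are the same identity. A linear identity is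 trivial if it is of the form ${}_{i}()_{i}$, where $()$ is the identity permutation. An identity $\varphi$ implies an identity $\psi$ if every groupoid satisfying $\varphi$ also satisfies $\psi$. *)

theory Defs
  imports "HOL-Algebra.Sym_Groups"
begin

datatype 'v gterm = Var 'v | Mult "'v gterm" "'v gterm"

type_synonym bracketing = "unit gterm"

definition bracketing_of :: "'v gterm \<Rightarrow> bracketing" where
  "bracketing_of t = map_gterm (\<lambda>_. ()) t"

primrec leaves :: "'v gterm \<Rightarrow> 'v list" where
  "leaves (Var x) = [x]"
| "leaves (Mult l r) = leaves l @ leaves r"

abbreviation len :: "'v gterm \<Rightarrow> nat" where
  "len t \<equiv> length (leaves t)"

text \<open>Indexed by the number of leaves; the value at 0 is a dummy that is never used.\<close>

fun catalan :: "nat \<Rightarrow> nat" where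
  "catalan 0 = 0"
| "catalan (Suc 0) = 1"
| "catalan (Suc (Suc n)) = (\<Sum>k = 1..Suc n. catalan k * catalan (Suc (Suc n) - k))"

text \<open>In the second equation \<open>n = len l + len r\<close> and \<open>m = len r\<close>, so \<open>n - m = len l\<close>.\<close>

primrec label :: "bracketing \<Rightarrow> nat" where
  "label (Var x) = 0"
| "label (Mult l r) =
     (\<Sum>k = 1..len r - 1. catalan k * catalan (len l + len r - k))
       + label r * catalan (len l) + label l"

text \<open>An identity \<open>u = v\<close> is the pair \<open>(u, v)\<close>; variables are named by natural numbers.\<close>

type_synonym identity = "nat gterm \<times> nat gterm"

text \<open>A linear identity of length \<open>2n\<close>, i.e. each side has length \<open>n\<close>.\<close>

definition linear_identity :: "nat \<Rightarrow> identity \<Rightarrow> bool" where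
  "linear_identity n \<phi> \<longleftrightarrow> (case \<phi> of (u, v) \<Rightarrow>
     distinct (leaves u) \<and> distinct (leaves v) \<and> set (leaves u) = set (leaves v) \<and>
     len u = n \<and> len v = n)"

text \<open>\<open>denotes n i f j \<phi>\<close>: the linear identity \<open>\<phi>\<close> of length \<open>2n\<close> is \<open>\<^sub>if\<^sub>j\<close>. Positions and the
  permutations in \<^term>\<open>sym_group n\<close> are 1-based, list indices are 0-based.\<close>

definition denotes :: "nat \<Rightarrow> nat \<Rightarrow> (nat \<Rightarrow> nat) \<Rightarrow> nat \<Rightarrow> identity \<Rightarrow> bool" where
  "denotes n i f j \<phi> \<longleftrightarrow> linear_identity n \<phi> \<and> f \<in> carrier (sym_group n) \<and>
     (case \<phi> of (u, v) \<Rightarrow>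
        label (bracketing_of u) = i \<and> label (bracketing_of v) = j \<and>
        (\<forall>p\<in>{1..n}. leaves v ! (f p - 1) = leaves u ! (p - 1)))"

definition trivial_identity :: "nat \<Rightarrow> identity \<Rightarrow> bool" where
  "trivial_identity n \<phi> \<longleftrightarrow> (\<exists>i. denotes n i id i \<phi>)"

text \<open>Equality of identities, up to renaming of variables and interchanging the two sides.\<close>

definition same_identity :: "identity \<Rightarrow> identity \<Rightarrow> bool" where
  "same_identity \<phi> \<psi> \<longleftrightarrow> (case \<phi> of (u, v) \<Rightarrow>
     \<exists>\<sigma>. inj_on \<sigma> (set_gterm u \<union> set_gterm v) \<and>
       (\<psi> = (map_gterm \<sigma> u, map_gterm \<sigma> v) \<or> \<psi> = (map_gterm \<sigma> v, map_gterm \<sigma> u)))"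

definition groupoid :: "'a set \<Rightarrow> ('a \<Rightarrow> 'a \<Rightarrow> 'a) \<Rightarrow> bool" where
  "groupoid A m \<longleftrightarrow> (\<forall>x\<in>A. \<forall>y\<in>A. m x y \<in> A)"

primrec eval :: "('a \<Rightarrow> 'a \<Rightarrow> 'a) \<Rightarrow> ('v \<Rightarrow> 'a) \<Rightarrow> 'v gterm \<Rightarrow> 'a" where
  "eval m \<rho> (Var x) = \<rho> x"
| "eval m \<rho> (Mult s t) = m (eval m \<rho> s) (eval m \<rho> t)"

definition satisfies :: "'a set \<Rightarrow> ('a \<Rightarrow> 'a \<Rightarrow> 'a) \<Rightarrow> identity \<Rightarrow> bool" where
  "satisfies A m \<phi> \<longleftrightarrow> (\<forall>\<rho>. range \<rho> \<subseteq> A \<longrightarrow> eval m \<rho> (fst \<phi>) = eval m \<rho> (snd \<phi>))"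

text \<open>HOL cannot quantify over all types inside a formula, so implication is relative to a type
  \<open>'a\<close> and ranges over all groupoids whose carrier is a subset of \<open>'a\<close>. An equivalence
  \<open>implies TYPE('a) \<phi> \<psi> \<longleftrightarrow> P\<close> proved for every infinite type \<open>'a\<close>, with \<open>P\<close> independent of
  \<open>'a\<close>, yields the equivalence for implication over all groupoids: each groupoid
  lives on a subset of some infinite type.\<close>

definition implies :: "'a itself \<Rightarrow> identity \<Rightarrow> identity \<Rightarrow> bool" where
  "implies T \<phi> \<psi> \<longleftrightarrow>
     (\<forall>(A :: 'a set) m. groupoid A m \<and> satisfies A m \<phi> \<longrightarrow> satisfies A m \<psi>)"

text \<open>The example \<open>((xy)u)v = (xu)(vy)\<close>, denoted \<open>\<^sub>0f\<^sub>2\<close> with \<open>f = (2,4,3)\<close>, fixes the direction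
  of \<open>f\<close> and the order of the labelling.\<close>

lemma denotes_example:
  assumes "f \<in> carrier (sym_group 4)" "f 1 = 1" "f 2 = 4" "f 4 = 3" "f 3 = 2"
    and "distinct [x, y, u, v]"
  shows "denotes 4 0 f 2
    (Mult (Mult (Mult (Var x) (Var y)) (Var u)) (Var v),
     Mult (Mult (Var x) (Var u)) (Mult (Var v) (Var y)))"
proof -
  have "{1..4::nat} = {1, 2, 3, 4}"
    by auto
  then show ?thesis
    using assms
    by (auto simp: denotes_def linear_identity_def bracketing_of_def numeral_eq_Suc)
qed

end

theory Submission
  imports Defs "HOL-Library.Countable"
begin

text \<open>A side of a linear identity \<open>\<phi>\<close> of length \<open>2n\<close> matches a term of length \<open>n\<close> only at the root
  and only by substituting variables for variables, and every other instance is longer than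
  \<open>n\<close>. Collapsing all longer terms therefore gives a groupoid satisfying \<open>\<phi>\<close> in which two terms of
  length \<open>n\<close> are equal only if they are connected by renamings of \<open>\<phi>\<close>. If the two sides of \<open>\<phi>\<close>
  have different bracketings, a chain of renamings can only go back and forth; if they have the
  same bracketing, a chain composes powers of \<open>f\<close>.\<close>

section \<open>The labelling of bracketings\<close>

lemma len_pos: "0 < len t"
  by (induction t) auto

lemma leaves_map_gterm: "leaves (map_gterm \<sigma> t) = map \<sigma> (leaves t)"
  by (induction t) auto

lemma set_leaves: "set (leaves t) = set_gterm t"
  by (induction t) auto

lemma len_bracketing_of [simp]: "len (bracketing_of t) = len t"
  by (simp add: bracketing_of_def leaves_map_gterm)

lemma bracketing_of_map_gterm [simp]: "bracketing_of (map_gterm \<sigma> t) = bracketing_of t"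
  by (simp add: bracketing_of_def gterm.map_comp comp_def)

lemma bracketing_of_simps [simp]:
  "bracketing_of (Var x) = Var ()"
  "bracketing_of (Mult l r) = Mult (bracketing_of l) (bracketing_of r)"
  by (simp_all add: bracketing_of_def)

lemma catalan_add:
  assumes "0 < a" "0 < b"
  shows "catalan (a + b) = (\<Sum>k = 1..a + b - 1. catalan k * catalan (a + b - k))"
proof -
  obtain m where "a + b = Suc (Suc m)"
    using assms by (metis add_gr_0 add_Suc_right add_Suc gr0_implies_Suc)
  then show ?thesis by simp
qed

lemma catalan_convolution_step:
  assumes "0 < a" "0 < b"
  shows "(\<Sum>k = 1..b - 1. catalan k * catalan (a + b - k)) + catalan b * catalan a
    = (\<Sum>k = 1..b. catalan k * catalan (a + b - k))"
  using assms by (cases b) auto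

text \<open>For a fixed length \<open>m\<close> of the right factor, \<open>label r\<close> and
  \<open>label l\<close> are digits of a mixed-radix number below
  \<open>catalan m * catalan (len l)\<close>. The label therefore stays below the start of the block
  for right length \<open>m + 1\<close>.\<close>

lemma label_Mult_bound:
  assumes "label l < catalan (len l)" "label r < catalan (len r)"
  shows "label (Mult l r) < (\<Sum>k = 1..len r. catalan k * catalan (len l + len r - k))"
proof -
  have "label r * catalan (len l) + label l < Suc (label r) * catalan (len l)"
    using assms(1) by simp
  also have "\<dots> \<le> catalan (len r) * catalan (len l)"
    using assms(2) by (intro mult_le_mono1) simp
  finally show ?thesis
    using catalan_convolution_step[OF len_pos len_pos, of l r] by simp
qed

lemma label_less_catalan: "label t < catalan (len t)"
proof (induction t)
  case (Mult l r)
  have "label (Mult l r) < (\<Sum>k = 1..len r. catalan k * catalan (len l + len r - k))"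
    using Mult by (rule label_Mult_bound)
  also have "len r \<le> len l + len r - 1"
    using len_pos[of l] by linarith
  then have "(\<Sum>k = 1..len r. catalan k * catalan (len l + len r - k))
      \<le> (\<Sum>k = 1..len l + len r - 1. catalan k * catalan (len l + len r - k))"
    by (intro sum_mono2) auto
  finally show ?case
    using catalan_add[OF len_pos len_pos, of l r] by simp
qed simp

text \<open>Right factors of different lengths get disjoint blocks of labels: if \<open>r'\<close>
  were longer than \<open>r\<close>, the block of \<open>Mult l' r'\<close> would start only after
  \<open>label (Mult l r)\<close>.\<close>

lemma label_Mult_len_right_le:
  assumes "label (Mult l r) = label (Mult l' r')" "len l + len r = len l' + len r'"
  shows "len r' \<le> len r"
proof (rule ccontr)
  assume "\<not> len r' \<le> len r"
  then have "(\<Sum>k = 1..len r. catalan k * catalan (len l + len r - k))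
      \<le> (\<Sum>k = 1..len r' - 1. catalan k * catalan (len l + len r - k))"
    by (intro sum_mono2) auto
  then show False
    using label_Mult_bound[OF label_less_catalan label_less_catalan, of l r] assms by simp
qed

text \<open>Decoding goes from coarse to fine: the block gives the lengths of both factors, the
  remainder modulo \<open>catalan (len l)\<close> gives \<open>label l\<close>, and the quotient
  gives \<open>label r\<close>.\<close>

lemma label_inject:
  assumes "label t = label t'" "len t = len t'"
  shows "t = t'"
  using assms
proof (induction t arbitrary: t')
  case (Var x)
  then show ?case
  proof (cases t')
    case (Mult l' r')
    then show ?thesis
      using Var(2) len_pos[of l'] len_pos[of r'] by (simp del: length_greater_0_conv)
  qed simp
next
  case (Mult l r)
  show ?case
  proof (cases t')
    case (Var x)
    then show ?thesis
      using Mult.prems(2) len_pos[of l] len_pos[of r] by (simp del: length_greater_0_conv)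
  next
    case t': (Mult l' r')
    have sum: "len l + len r = len l' + len r'"
      using Mult.prems(2) t' by simp
    have "len r' \<le> len r"
      using Mult.prems(1) sum unfolding t' by (rule label_Mult_len_right_le)
    moreover have "len r \<le> len r'"
      using Mult.prems(1)[symmetric] sum[symmetric] unfolding t' by (rule label_Mult_len_right_le)
    ultimately have lens: "len r = len r'" "len l = len l'"
      using sum by simp_all
    then have eq: "label r * catalan (len l) + label l = label r' * catalan (len l) + label l'"
      using Mult.prems(1) t' by simp
    have less: "label l < catalan (len l)" "label l' < catalan (len l)"
      using label_less_catalan[of l] label_less_catalan[of l'] lens by auto
    have "label l = label l'"
      using arg_cong[OF eq, of "\<lambda>x. x mod catalan (len l)"] less by simp
    moreover from this have "label r = label r'"
      using eq less by auto
    ultimately show ?thesis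
      using Mult.IH lens t' by simp
  qed
qed

section \<open>Implication as connectedness by renamings\<close>

text \<open>The maps \<sigma> need not be injective, since a substitution may identify
  variables.\<close>

definition renamings :: "identity \<Rightarrow> (nat gterm \<times> nat gterm) set" where
  "renamings \<phi> = range (\<lambda>\<sigma>. (map_gterm \<sigma> (fst \<phi>), map_gterm \<sigma> (snd \<phi>)))"

definition connected_by :: "identity \<Rightarrow> (nat gterm \<times> nat gterm) set" where
  "connected_by \<phi> = (renamings \<phi> \<union> (renamings \<phi>)\<inverse>)\<^sup>*"

lemma eval_map_gterm: "eval m \<rho> (map_gterm \<sigma> t) = eval m (\<rho> \<circ> \<sigma>) t"
  by (induction t) auto

lemma satisfies_connected:
  assumes "satisfies A m \<phi>" "(p, q) \<in> connected_by \<phi>"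
  shows "satisfies A m (p, q)"
proof -
  have "eval m \<rho> p = eval m \<rho> q" if "range \<rho> \<subseteq> A" for \<rho>
    using assms(2) unfolding connected_by_def
  proof (induction rule: rtrancl_induct)
    case (step y z)
    have "eval m (\<rho> \<circ> \<sigma>) (fst \<phi>) = eval m (\<rho> \<circ> \<sigma>) (snd \<phi>)" for \<sigma>
    proof -
      have "range (\<rho> \<circ> \<sigma>) \<subseteq> A" using that by auto
      then show ?thesis using assms(1) by (simp add: satisfies_def)
    qed
    then have "eval m \<rho> y = eval m \<rho> z"
      using step(2) by (auto simp: renamings_def eval_map_gterm)
    then show ?case using step.IH by simp
  qed simp
  then show ?thesis by (simp add: satisfies_def)
qed

text \<open>The separating groupoid will live on terms, while \<open>implies\<close> speaks about
  subsets of \<open>'a\<close>. Copying the operation along \<open>e\<close> onto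
  \<open>range e\<close> bridges the gap.\<close>

lemma implies_transfer:
  fixes e :: "'b \<Rightarrow> 'a" and m :: "'b \<Rightarrow> 'b \<Rightarrow> 'b"
  assumes "implies TYPE('a) \<phi> \<psi>" "inj e" "satisfies UNIV m \<phi>"
  shows "satisfies UNIV m \<psi>"
proof -
  define m' where "m' x y = e (m (inv' e x) (inv' e y))" for x y
  have hom: "eval m' (e \<circ> \<rho>) t = e (eval m \<rho> t)" for \<rho> and t :: "nat gterm"
    using assms(2) by (induction t) (auto simp: m'_def)
  have "groupoid (range e) m'"
    by (simp add: groupoid_def m'_def)
  moreover have "satisfies (range e) m' \<phi>"
    unfolding satisfies_def
  proof (intro allI impI)
    fix \<rho> :: "nat \<Rightarrow> 'a"
    assume "range \<rho> \<subseteq> range e"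
    then have "\<rho> = e \<circ> (inv' e \<circ> \<rho>)"
      by (auto simp: fun_eq_iff f_inv_into_f image_subset_iff)
    moreover have "eval m (inv' e \<circ> \<rho>) (fst \<phi>) = eval m (inv' e \<circ> \<rho>) (snd \<phi>)"
      using assms(3) by (simp add: satisfies_def)
    ultimately show "eval m' \<rho> (fst \<phi>) = eval m' \<rho> (snd \<phi>)"
      by (metis hom)
  qed
  ultimately have "satisfies (range e) m' \<psi>"
    using assms(1) by (simp add: implies_def)
  then have "e (eval m \<rho> (fst \<psi>)) = e (eval m \<rho> (snd \<psi>))" for \<rho>
    unfolding satisfies_def hom[symmetric] by (simp add: image_subset_iff)
  then show ?thesis
    using assms(2) by (auto simp: satisfies_def dest: injD)
qed

text \<open>The intended \<open>a\<close> and \<open>b\<close> have length \<open>n\<close>, so they generate no further products: \<open>b\<close> is an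
  absorbing value, and \<open>a\<close> marks the membership of a term of length \<open>n\<close> in \<open>K\<close>.\<close>

definition truncated_mult ::
    "nat \<Rightarrow> 'v gterm set \<Rightarrow> 'v gterm \<Rightarrow> 'v gterm \<Rightarrow> 'v gterm \<Rightarrow> 'v gterm \<Rightarrow> 'v gterm" where
  "truncated_mult n K a b s t =
     (if len s + len t < n then Mult s t
      else if len s + len t = n \<and> Mult s t \<in> K then a else b)"

text \<open>Below length \<open>n\<close> the product is free. A factor of length at least
  \<open>n\<close> makes the product \<open>b\<close>, and since \<open>a\<close> and
  \<open>b\<close> have length \<open>n\<close> themselves, the collapse persists upwards. Variables
  are set apart because \<rho> may assign them long terms outright.\<close>

lemma eval_truncated_mult:
  fixes \<rho> :: "'w \<Rightarrow> 'v gterm"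
  assumes "len a = n" "len b = n"
  shows "eval (truncated_mult n K a b) \<rho> t =
    (if len (eval Mult \<rho> t) < n \<or> (\<exists>x. t = Var x) then eval Mult \<rho> t
     else if len (eval Mult \<rho> t) = n \<and> eval Mult \<rho> t \<in> K then a else b)"
proof (induction t)
  case (Mult l r)
  let ?e = "eval (truncated_mult n K a b) \<rho>"
  have short: "?e s = eval Mult \<rho> s" if "s = l \<or> s = r" "len (eval Mult \<rho> s) < n" for s
    using Mult that by auto
  have long: "n \<le> len (?e s)" if "s = l \<or> s = r" "n \<le> len (eval Mult \<rho> s)" for s
    using Mult that assms by auto
  have pos: "0 < len (eval Mult \<rho> s)" "0 < len (?e s)" for s
    by (rule len_pos)+
  have prod: "?e (Mult l r) =
      (if len (?e l) + len (?e r) < n then Mult (?e l) (?e r)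
       else if len (?e l) + len (?e r) = n \<and> Mult (?e l) (?e r) \<in> K then a else b)"
    by (simp only: eval.simps truncated_mult_def[of n K a b "?e l" "?e r"])
  have sum: "len (eval Mult \<rho> (Mult l r)) = len (eval Mult \<rho> l) + len (eval Mult \<rho> r)"
    by simp
  show ?case
  proof (cases "len (eval Mult \<rho> l) < n \<and> len (eval Mult \<rho> r) < n")
    case True
    then show ?thesis
      unfolding prod using short[of l] short[of r] by simp
  next
    case False
    then have "n \<le> len (?e l) \<or> n \<le> len (?e r)"
      using long[of l] long[of r] by auto
    \<comment> \<open>The other factor has positive length, so the total exceeds \<open>n\<close>
      strictly, for the truncated and for the free values alike.\<close>
    then have "n < len (?e l) + len (?e r)"
      using pos(2)[of l] pos(2)[of r] by linarith
    moreover have "n < len (eval Mult \<rho> (Mult l r))"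
      using False pos(1)[of l] pos(1)[of r] unfolding sum by linarith
    ultimately show ?thesis
      unfolding prod by simp
  qed
qed simp

lemma len_eval_Mult: "len (eval Mult \<rho> t) = (\<Sum>x\<leftarrow>leaves t. len (\<rho> x))"
  by (induction t) auto

lemma len_eval_Mult_linear:
  assumes "distinct (leaves u)"
  shows "len (eval Mult \<rho> u) = (\<Sum>x\<in>set (leaves u). len (\<rho> x))"
  using assms by (simp add: len_eval_Mult sum_list_distinct_conv_sum_set)

text \<open>Every variable contributes at least 1 to the length of the value, so a single compound
  \<open>\<rho> x\<close> would already push it beyond \<open>len u\<close>.\<close>

lemma eval_Mult_renaming:
  assumes "distinct (leaves u)" "len (eval Mult \<rho> u) \<le> len u" "x \<in> set (leaves u)"
  shows "\<exists>y. \<rho> x = Var y"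
proof (cases "\<rho> x")
  case (Mult l r)
  have "len u = (\<Sum>x\<in>set (leaves u). 1)"
    using assms(1) by (simp add: distinct_card)
  also have "\<dots> < (\<Sum>x\<in>set (leaves u). len (\<rho> x))"
  proof (rule sum_strict_mono_ex1)
    show "\<forall>x\<in>set (leaves u). 1 \<le> len (\<rho> x)"
      using len_pos by (metis One_nat_def Suc_leI)
    have "1 < len (\<rho> x)"
      using Mult len_pos[of l] len_pos[of r] by (simp del: length_greater_0_conv)
    then show "\<exists>x\<in>set (leaves u). 1 < len (\<rho> x)"
      using assms(3) by blast
  qed simp
  finally show ?thesis
    using assms(1,2) by (simp add: len_eval_Mult_linear)
qed simp

lemma eval_Mult_Var:
  assumes "\<And>x. x \<in> set (leaves t) \<Longrightarrow> \<rho> x = Var (\<sigma> x)"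
  shows "eval Mult \<rho> t = map_gterm \<sigma> t"
  using assms by (induction t) auto

instance gterm :: (countable) countable
  by countable_datatype

text \<open>By contraposition: if \<open>q\<close> lies outside the class of \<open>p\<close>, the
  truncated groupoid for that class satisfies \<phi> but separates \<open>p\<close> from
  \<open>q\<close>.\<close>

lemma connected_if_implies:
  assumes inf: "infinite (UNIV :: 'a set)" and n: "n \<ge> 2"
    and lin: "linear_identity n \<phi>" and len: "len p = n" "len q = n"
    and imp: "implies TYPE('a) \<phi> (p, q)"
  shows "(p, q) \<in> connected_by \<phi>"
proof (rule ccontr)
  assume neg: "(p, q) \<notin> connected_by \<phi>"
  obtain u v where \<phi>: "\<phi> = (u, v)" by (cases \<phi>)
  have uv: "distinct (leaves u)" "distinct (leaves v)" "set (leaves u) = set (leaves v)"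
    "len u = n" "len v = n"
    using lin by (auto simp: linear_identity_def \<phi>)
  \<comment> \<open>With \<open>p\<close> as the mark of \<open>K\<close> and \<open>q\<close> as
    the absorbing value, evaluation at \<open>Var\<close> will fix both terms.\<close>
  define K where "K = {t. (p, t) \<in> connected_by \<phi>}"
  let ?m = "truncated_mult n K p q"
  \<comment> \<open>As \<open>n \<ge> 2\<close>, terms of length \<open>n\<close> are products,
    which excludes the variable case of \<open>eval_truncated_mult\<close>.\<close>
  have nonvar: "\<not> (\<exists>x. t = Var x)" if "len t = n" for t :: "nat gterm"
    using that n by auto
  have closed: "map_gterm \<sigma> u \<in> K \<longleftrightarrow> map_gterm \<sigma> v \<in> K" for \<sigma>
  proof -
    have "(map_gterm \<sigma> u, map_gterm \<sigma> v) \<in> renamings \<phi>"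
      unfolding renamings_def \<phi> by auto
    then show ?thesis
      unfolding K_def connected_by_def by (blast intro: rtrancl_into_rtrancl)
  qed
  \<comment> \<open>At total length \<open>n\<close> every variable of \<open>u\<close> receives a
    single variable, so both values are renamings and \<open>closed\<close> applies.\<close>
  have mem: "eval Mult \<rho> u \<in> K \<longleftrightarrow> eval Mult \<rho> v \<in> K"
    if "len (eval Mult \<rho> u) = n" for \<rho> :: "nat \<Rightarrow> nat gterm"
  proof -
    have "\<forall>x\<in>set (leaves u). \<exists>y. \<rho> x = Var y"
      using eval_Mult_renaming[OF uv(1)] that uv(4) by (metis order_refl)
    then obtain \<sigma> where "\<forall>x\<in>set (leaves u). \<rho> x = Var (\<sigma> x)"
      by metis
    then show ?thesis
      using uv(3) closed[of \<sigma>] eval_Mult_Var[of u \<rho> \<sigma>] eval_Mult_Var[of v \<rho> \<sigma>] by simp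
  qed
  have same_len: "len (eval Mult \<rho> u) = len (eval Mult \<rho> v)" for \<rho> :: "nat \<Rightarrow> nat gterm"
    using uv by (simp add: len_eval_Mult_linear)
  have not_less: "\<not> len (eval Mult \<rho> u) < n" for \<rho> :: "nat \<Rightarrow> nat gterm"
  proof -
    have "(\<Sum>x\<in>set (leaves u). 1) \<le> (\<Sum>x\<in>set (leaves u). len (\<rho> x))"
      by (intro sum_mono Suc_leI[OF len_pos, folded One_nat_def])
    then show ?thesis
      using uv by (simp add: len_eval_Mult_linear distinct_card)
  qed
  have "eval ?m \<rho> u = eval ?m \<rho> v" for \<rho>
    unfolding eval_truncated_mult[OF len]
    using nonvar[OF uv(4)] nonvar[OF uv(5)] mem[of \<rho>] same_len[of \<rho>] not_less[of \<rho>]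
    by auto
  then have "satisfies UNIV ?m \<phi>"
    by (simp add: satisfies_def \<phi>)
  \<comment> \<open>The carrier consists of countably many terms and hence embeds into any infinite
    type.\<close>
  moreover obtain h :: "nat \<Rightarrow> 'a" where "inj h"
    using inf infinite_countable_subset by blast
  then have "inj (h \<circ> (to_nat :: nat gterm \<Rightarrow> nat))"
    by (intro inj_compose) auto
  ultimately have sat: "satisfies UNIV ?m (p, q)"
    using implies_transfer[OF imp] by blast
  have "eval Mult Var t = t" for t :: "nat gterm"
    by (induction t) auto
  moreover have "p \<in> K" "q \<notin> K"
    using neg by (auto simp: K_def connected_by_def)
  ultimately have "eval ?m Var p = p" "eval ?m Var q = q"
    unfolding eval_truncated_mult[OF len] using len nonvar by auto
  then have "p = q"
    using sat by (auto simp: satisfies_def)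
  then show False
    using neg by (simp add: connected_by_def)
qed

section \<open>Chains of renamings\<close>

text \<open>The image of \<open>u\<close> determines \<sigma> on the variables of \<open>u\<close>,
  which are those of \<open>v\<close>. Applied in both directions, this makes
  \<open>renamings\<close> a partial injection.\<close>

lemma map_gterm_agree:
  assumes "map_gterm \<sigma> u = map_gterm \<tau> u" "set (leaves v) = set (leaves u)"
  shows "map_gterm \<sigma> v = map_gterm \<tau> v"
proof -
  have "\<forall>x\<in>set (leaves u). \<sigma> x = \<tau> x"
    using assms(1) by (metis leaves_map_gterm map_eq_conv)
  then show ?thesis
    using assms(2) by (intro gterm.map_cong0) (simp add: set_leaves)
qed

text \<open>Sources of \<open>renamings\<close> have the bracketing of \<open>u\<close> and targets
  that of \<open>v\<close>, so two forward steps never compose. After one step the only continuation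
  is its own reversal.\<close>

lemma connected_by_different_bracketings:
  assumes "linear_identity n (u, v)" "bracketing_of u \<noteq> bracketing_of v"
    and "(p, q) \<in> connected_by (u, v)"
  shows "q = p \<or> (p, q) \<in> renamings (u, v) \<or> (q, p) \<in> renamings (u, v)"
  using assms(3) unfolding connected_by_def
proof (induction rule: rtrancl_induct)
  case (step y z)
  have sets: "set (leaves v) = set (leaves u)" "set (leaves u) = set (leaves v)"
    using assms(1) by (auto simp: linear_identity_def)
  have clash: "map_gterm \<sigma> u \<noteq> map_gterm \<tau> v" for \<sigma> \<tau> :: "nat \<Rightarrow> nat"
    using assms(2) by (metis bracketing_of_map_gterm)
  have functional: "z = z'" if "(y, z) \<in> renamings (u, v)" "(y, z') \<in> renamings (u, v)" for y z z'
    using that map_gterm_agree[OF _ sets(1)] by (auto simp: renamings_def)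
  have injective: "z = z'" if "(z, y) \<in> renamings (u, v)" "(z', y) \<in> renamings (u, v)" for y z z'
    using that map_gterm_agree[OF _ sets(2)] by (auto simp: renamings_def)
  have no_chain: "\<not> ((x, y) \<in> renamings (u, v) \<and> (y, z) \<in> renamings (u, v))" for x y z
    using clash by (auto simp: renamings_def) metis
  show ?case
    using step functional injective no_chain by blast
qed simp

section \<open>Terms of equal bracketing related by a permutation of positions\<close>

definition permuted_by :: "(nat \<Rightarrow> nat) \<Rightarrow> 'v gterm \<Rightarrow> 'v gterm \<Rightarrow> bool" where
  "permuted_by f t t' \<longleftrightarrow> bracketing_of t = bracketing_of t' \<and>
     (\<forall>p\<in>{1..len t}. leaves t' ! (f p - 1) = leaves t ! (p - 1))"

lemma gterm_eqI:
  assumes "bracketing_of t = bracketing_of t'" "leaves t = leaves t'"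
  shows "t = t'"
  using assms
proof (induction t arbitrary: t')
  case (Var x)
  then show ?case by (cases t') auto
next
  case (Mult l r)
  then obtain l' r' where t': "t' = Mult l' r'" by (cases t') auto
  then have "len l = len l'"
    using Mult.prems(1) by (metis bracketing_of_simps(2) gterm.inject(2) len_bracketing_of)
  then show ?case
    using Mult t' by auto
qed

lemma permuted_by_len: "permuted_by f t t' \<Longrightarrow> len t' = len t"
  unfolding permuted_by_def by (metis len_bracketing_of)

lemma permuted_by_id: "permuted_by id t t"
  by (simp add: permuted_by_def)

lemma permuted_by_comp:
  assumes "permuted_by f t t'" "permuted_by g t' t''" "f permutes {1..len t}"
  shows "permuted_by (g \<circ> f) t t''"
proof -
  have "f p \<in> {1..len t'}" if "p \<in> {1..len t}" for p
    using that assms(3) permuted_by_len[OF assms(1)] by (metis permutes_in_image)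
  then show ?thesis
    using assms by (simp add: permuted_by_def)
qed

lemma permuted_by_inv:
  assumes "permuted_by f t t'" "f permutes {1..len t}"
  shows "permuted_by (inv' f) t' t"
proof -
  have "inv' f p \<in> {1..len t}" "f (inv' f p) = p" if "p \<in> {1..len t'}" for p
    using that assms(2) permuted_by_len[OF assms(1)]
    by (metis permutes_in_image permutes_inv) (metis assms(2) permutes_inverses(1))
  then show ?thesis
    using assms(1) unfolding permuted_by_def by metis
qed

text \<open>Since \<open>f\<close> is onto the positions, every leaf of the result is
  prescribed.\<close>

lemma permuted_by_right_unique:
  assumes "permuted_by f t t1" "permuted_by f t t2" "f permutes {1..len t}"
  shows "t1 = t2"
proof (rule gterm_eqI)
  show "bracketing_of t1 = bracketing_of t2"
    using assms(1,2) by (simp add: permuted_by_def)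
  show "leaves t1 = leaves t2"
  proof (rule nth_equalityI)
    show "len t1 = len t2"
      using assms(1,2) by (simp add: permuted_by_len)
    fix k assume "k < len t1"
    then have "Suc k \<in> {1..len t}"
      using permuted_by_len[OF assms(1)] by auto
    then obtain p where "p \<in> {1..len t}" "f p = Suc k"
      using assms(3) by (metis permutes_image imageE)
    then show "leaves t1 ! k = leaves t2 ! k"
      using assms(1,2) unfolding permuted_by_def by (metis diff_Suc_1)
  qed
qed

text \<open>With distinct leaves the new position of each leaf can be read off from the result. This
  turns a chain from \<open>p\<close> to \<open>q\<close> into an equation between \<open>g\<close>
  and a power of \<open>f\<close>.\<close>

lemma permuted_by_perm_unique:
  assumes "permuted_by f t t'" "permuted_by g t t'" "distinct (leaves t')"
    and "f permutes {1..len t}" "g permutes {1..len t}"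
  shows "f = g"
proof
  fix p
  show "f p = g p"
  proof (cases "p \<in> {1..len t}")
    case True
    then have "f p \<in> {1..len t}" "g p \<in> {1..len t}"
      using assms(4,5) by (metis permutes_in_image)+
    moreover have "leaves t' ! (f p - 1) = leaves t' ! (g p - 1)"
      using True assms(1,2) by (simp add: permuted_by_def)
    ultimately have "f p - 1 = g p - 1"
      using assms(3) permuted_by_len[OF assms(1)]
      by (subst (asm) nth_eq_iff_index_eq) auto
    then show ?thesis
      using \<open>f p \<in> _\<close> \<open>g p \<in> _\<close> by auto
  next
    case False
    then show ?thesis
      using assms(4,5) by (simp add: permutes_not_in)
  qed
qed

lemma permuted_by_map_gterm:
  assumes "permuted_by f u v" "f permutes {1..len u}"
  shows "permuted_by f (map_gterm \<sigma> u) (map_gterm \<sigma> v)"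
proof -
  have "f p - 1 < len v" if "p \<in> {1..len u}" for p
  proof -
    have "f p \<in> {1..len v}"
      using that assms permuted_by_len[OF assms(1)] by (metis permutes_in_image)
    then show ?thesis by auto
  qed
  then show ?thesis
    using assms(1) by (auto simp: permuted_by_def leaves_map_gterm)
qed

text \<open>Pairing the leaves of \<open>u\<close> with those of \<open>t\<close> gives a
  well-defined map because the former are distinct; those of \<open>t\<close> may repeat.\<close>

lemma ex_renaming:
  assumes "distinct (leaves u)" "bracketing_of t = bracketing_of u"
  shows "\<exists>\<sigma>. t = map_gterm \<sigma> u"
proof -
  have "len t = len u"
    using assms(2) by (metis len_bracketing_of)
  then have "map (the \<circ> map_of (zip (leaves u) (leaves t))) (leaves u) = leaves t"
    using assms(1) by (intro nth_equalityI) (auto simp: map_of_zip_nth)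
  then have "t = map_gterm (the \<circ> map_of (zip (leaves u) (leaves t))) u"
    using assms(2) by (simp add: gterm_eqI leaves_map_gterm)
  then show ?thesis by blast
qed

text \<open>Renaming acts on names and \<open>f\<close> on positions, so the two commute.
  Conversely, a term with the bracketing of \<open>u\<close> is a renaming of \<open>u\<close>, and
  its partner is then forced.\<close>

lemma permuted_by_renamings:
  assumes "permuted_by f u v" "f permutes {1..len u}" "distinct (leaves u)"
  shows "(t, t') \<in> renamings (u, v) \<longleftrightarrow> bracketing_of t = bracketing_of u \<and> permuted_by f t t'"
proof
  assume "(t, t') \<in> renamings (u, v)"
  then show "bracketing_of t = bracketing_of u \<and> permuted_by f t t'"
    using permuted_by_map_gterm[OF assms(1,2)] by (auto simp: renamings_def)
next
  assume t: "bracketing_of t = bracketing_of u \<and> permuted_by f t t'"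
  then obtain \<sigma> where \<sigma>: "t = map_gterm \<sigma> u"
    using ex_renaming[OF assms(3)] by blast
  moreover have "f permutes {1..len t}"
    using assms(2) t by (metis len_bracketing_of)
  ultimately have "t' = map_gterm \<sigma> v"
    using t permuted_by_map_gterm[OF assms(1,2)] permuted_by_right_unique by blast
  then show "(t, t') \<in> renamings (u, v)"
    using \<sigma> by (auto simp: renamings_def)
qed

section \<open>Powers of the permutation when both sides have the same bracketing\<close>

context
  fixes n :: nat and f :: "nat \<Rightarrow> nat" and u v :: "nat gterm"
  assumes uv: "permuted_by f u v" and f: "f \<in> carrier (sym_group n)"
    and u: "distinct (leaves u)" "len u = n"
begin

interpretation S: group "sym_group n"
  by (rule sym_group_is_group)

lemma sym_group_pow_permutes: "f [^]\<^bsub>sym_group n\<^esub> (k::int) permutes {1..n}"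
  using S.int_pow_closed[OF f] by (simp add: sym_group_carrier)

lemma sym_group_pow_Suc:
  "f [^]\<^bsub>sym_group n\<^esub> (k + 1 :: int) = f \<circ> f [^]\<^bsub>sym_group n\<^esub> k"
  using S.int_pow_mult[OF f, of 1 k] f by (simp add: sym_group_mult add.commute)

lemma sym_group_pow_pred:
  "f [^]\<^bsub>sym_group n\<^esub> (k - 1 :: int) = inv' f \<circ> f [^]\<^bsub>sym_group n\<^esub> k"
proof -
  have "bij f"
    using f by (simp add: sym_group_carrier permutes_bij)
  have "f [^]\<^bsub>sym_group n\<^esub> k = f \<circ> f [^]\<^bsub>sym_group n\<^esub> (k - 1)"
    using sym_group_pow_Suc[of "k - 1"] by simp
  then show ?thesis
    using \<open>bij f\<close> by (simp add: fun_eq_iff bij_is_inj)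
qed

lemma len_same_bracketing: "bracketing_of t = bracketing_of u \<Longrightarrow> len t = n"
  using u(2) by (metis len_bracketing_of)

lemma f_permutes: "f permutes {1..n}"
  using f by (simp add: sym_group_carrier)

lemma renamings_iff:
  "(t, t') \<in> renamings (u, v) \<longleftrightarrow> bracketing_of t = bracketing_of u \<and> permuted_by f t t'"
  using permuted_by_renamings[OF uv _ u(1)] u(2) f_permutes by simp

text \<open>The exponent counts forward steps minus backward steps. The case \<open>q = p\<close>
  stands apart because an empty chain says nothing about the bracketing of \<open>p\<close>.\<close>

lemma connected_by_same_bracketing:
  assumes "(p, q) \<in> connected_by (u, v)"
  shows "q = p \<or> bracketing_of p = bracketing_of u \<and>
    (\<exists>k::int. permuted_by (f [^]\<^bsub>sym_group n\<^esub> k) p q)"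
  using assms unfolding connected_by_def
proof (induction rule: rtrancl_induct)
  case (step y z)
  have brk: "bracketing_of y = bracketing_of u"
    using step(2) by (auto simp: renamings_iff permuted_by_def)
  \<comment> \<open>If the chain is still at \<open>p\<close>, the exponent is 0 and the bracketing
    of \<open>p\<close> comes from the step about to be made.\<close>
  obtain k :: int where p: "bracketing_of p = bracketing_of u"
    and k: "permuted_by (f [^]\<^bsub>sym_group n\<^esub> k) p y"
  proof (cases "y = p")
    case True
    then have "permuted_by (f [^]\<^bsub>sym_group n\<^esub> (0::int)) p y"
      by (simp add: permuted_by_id sym_group_one)
    then show ?thesis using that brk True by blast
  qed (use step.IH that in blast)
  have perm: "f [^]\<^bsub>sym_group n\<^esub> k permutes {1..len p}"
    using sym_group_pow_permutes len_same_bracketing[OF p] by simp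
  from step(2) consider "permuted_by f y z" | "permuted_by f z y" "len z = n"
    by (auto simp: renamings_iff len_same_bracketing)
  then show ?case
  proof cases
    case 1
    then have "permuted_by (f [^]\<^bsub>sym_group n\<^esub> (k + 1)) p z"
      using permuted_by_comp[OF k _ perm] by (simp add: sym_group_pow_Suc)
    then show ?thesis using p by blast
  next
    case 2
    then have "permuted_by (inv' f) y z"
      using permuted_by_inv f_permutes by metis
    then have "permuted_by (f [^]\<^bsub>sym_group n\<^esub> (k - 1)) p z"
      using permuted_by_comp[OF k _ perm] by (simp add: sym_group_pow_pred)
    then show ?thesis using p by blast
  qed
qed simp

lemma ex_permuted_by:
  assumes "bracketing_of t = bracketing_of u"
  shows "\<exists>t'. permuted_by f t t'" "\<exists>t'. permuted_by f t' t"
proof -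
  obtain \<sigma> where "t = map_gterm \<sigma> u"
    using ex_renaming[OF u(1) assms] by blast
  then show "\<exists>t'. permuted_by f t t'"
    using permuted_by_map_gterm[OF uv] f_permutes u(2) by auto
next
  \<comment> \<open>All \<open>n\<close> distinct leaves of \<open>u\<close> occur among the
    \<open>n\<close> leaves of \<open>v\<close>, so the latter cannot repeat.\<close>
  have "distinct (leaves v)"
  proof -
    have "leaves u = map (\<lambda>p. leaves v ! (f (Suc p) - 1)) [0..<n]"
      using uv u(2) by (intro nth_equalityI) (auto simp: permuted_by_def)
    moreover have "f (Suc p) - 1 < len v" if "p < n" for p
      using permutes_in_image[OF f_permutes, of "Suc p"] that permuted_by_len[OF uv] u(2)
      by auto
    ultimately have "set (leaves u) \<subseteq> set (leaves v)"
      by auto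
    then have "n \<le> card (set (leaves v))"
      using u by (metis List.finite_set card_mono distinct_card)
    then show ?thesis
      using permuted_by_len[OF uv] u(2)
      by (metis card_distinct card_length le_antisym)
  qed
  moreover have "bracketing_of t = bracketing_of v"
    using assms uv by (simp add: permuted_by_def)
  ultimately obtain \<sigma> where "t = map_gterm \<sigma> v"
    using ex_renaming by blast
  then show "\<exists>t'. permuted_by f t' t"
    using permuted_by_map_gterm[OF uv] f_permutes u(2) by auto
qed

text \<open>A walk from \<open>p\<close>, forward or backward, never gets stuck by
  \<open>ex_permuted_by\<close>. Its endpoint is \<open>p\<close> permuted by the required power,
  hence equals \<open>q\<close> by uniqueness.\<close>

lemma connected_if_permuted_by_pow:
  assumes p: "bracketing_of p = bracketing_of u"
    and "permuted_by (f [^]\<^bsub>sym_group n\<^esub> (k::int)) p q"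
  shows "(p, q) \<in> connected_by (u, v)"
proof -
  let ?P = "\<lambda>k t. permuted_by (f [^]\<^bsub>sym_group n\<^esub> (k::int)) p t"
  let ?R = "renamings (u, v) \<union> (renamings (u, v))\<inverse>"
  have perm: "f [^]\<^bsub>sym_group n\<^esub> (k::int) permutes {1..len p}" for k
    using sym_group_pow_permutes len_same_bracketing[OF p] by simp
  have "\<exists>t. ?P k t \<and> (p, t) \<in> ?R\<^sup>*"
  proof (induction k rule: int_induct[where k = 0])
    case base
    have "?P 0 p" by (simp add: permuted_by_id sym_group_one)
    then show ?case by blast
  next
    case (step1 k)
    then obtain t where t: "?P k t" "(p, t) \<in> ?R\<^sup>*" by blast
    then have brk: "bracketing_of t = bracketing_of u"
      using p by (simp add: permuted_by_def)
    then obtain t' where t': "permuted_by f t t'"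
      using ex_permuted_by(1) by blast
    then have "?P (k + 1) t'"
      using permuted_by_comp[OF t(1) _ perm] by (simp add: sym_group_pow_Suc)
    moreover have "(t, t') \<in> ?R"
      using t' brk by (simp add: renamings_iff)
    ultimately show ?case
      using t(2) by (meson rtrancl.rtrancl_into_rtrancl)
  next
    case (step2 k)
    then obtain t where t: "?P k t" "(p, t) \<in> ?R\<^sup>*" by blast
    then have brk: "bracketing_of t = bracketing_of u"
      using p by (simp add: permuted_by_def)
    then obtain t' where t': "permuted_by f t' t"
      using ex_permuted_by(2) by blast
    then have brk': "bracketing_of t' = bracketing_of u"
      using brk by (simp add: permuted_by_def)
    then have "permuted_by (inv' f) t t'"
      using permuted_by_inv[OF t'] f_permutes by (simp add: len_same_bracketing)
    then have "?P (k - 1) t'"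
      using permuted_by_comp[OF t(1) _ perm] by (simp add: sym_group_pow_pred)
    moreover have "(t, t') \<in> ?R"
      using t' brk' by (simp add: renamings_iff)
    ultimately show ?case
      using t(2) by (meson rtrancl.rtrancl_into_rtrancl)
  qed
  then show ?thesis
    using assms(2) permuted_by_right_unique[OF _ _ perm] unfolding connected_by_def by metis
qed

end

section \<open>Identities in the notation of labels and permutations\<close>

text \<open>Both sides have the same length, so equal labels give equal bracketings by
  \<open>label_inject\<close>.\<close>

lemma denotes_permuted_by:
  assumes "denotes n i f j (u, v)" "i = j"
  shows "permuted_by f u v"
  using assms label_inject[of "bracketing_of u" "bracketing_of v"]
  by (auto simp: denotes_def linear_identity_def permuted_by_def)

lemma trivial_identity_refl:
  assumes "linear_identity n (p, p)"
  shows "trivial_identity n (p, p)"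
proof -
  have "denotes n (label (bracketing_of p)) id (label (bracketing_of p)) (p, p)"
    using assms by (simp add: denotes_def sym_group_carrier permutes_id)
  then show ?thesis
    unfolding trivial_identity_def by blast
qed

text \<open>The leaves of \<open>p\<close> and of \<open>q\<close> are distinct, which forces
  \<sigma> to be injective on the variables involved.\<close>

lemma same_identity_renaming:
  assumes "linear_identity n (u, v)" "linear_identity n (p, q)"
    and "(p, q) \<in> renamings (u, v) \<or> (q, p) \<in> renamings (u, v)"
  shows "same_identity (u, v) (p, q)"
proof -
  obtain \<sigma> where \<sigma>: "(p, q) = (map_gterm \<sigma> u, map_gterm \<sigma> v) \<or>
      (p, q) = (map_gterm \<sigma> v, map_gterm \<sigma> u)"
    using assms(3) by (auto simp: renamings_def)
  have "distinct (map \<sigma> (leaves u))"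
    using \<sigma> assms(2) by (auto simp: linear_identity_def leaves_map_gterm)
  then have "inj_on \<sigma> (set_gterm u \<union> set_gterm v)"
    using assms(1) by (auto simp: linear_identity_def distinct_map set_leaves)
  then show ?thesis
    using \<sigma> by (auto simp: same_identity_def)
qed

theorem theorem4p1:
  fixes n i j r s :: nat and f g :: "nat \<Rightarrow> nat" and \<phi> \<psi> :: identity
  assumes "infinite (UNIV :: 'a set)"
    and "n \<ge> 3"
    and "denotes n i f j \<phi>" and "denotes n r g s \<psi>"
    and "\<not> trivial_identity n \<phi>" and "\<not> trivial_identity n \<psi>"
    and "\<not> same_identity \<phi> \<psi>"
  shows "implies TYPE('a) \<phi> \<psi> \<longleftrightarrow>
    i = j \<and> j = r \<and> r = s \<and> (\<exists>k::int. k \<noteq> 0 \<and> g = f [^]\<^bsub>sym_group n\<^esub> k)"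
proof -
  obtain u v p q where eqs: "\<phi> = (u, v)" "\<psi> = (p, q)"
    by (cases \<phi>, cases \<psi>)
  note \<phi> = assms(3)[unfolded eqs] and \<psi> = assms(4)[unfolded eqs]
  have lin: "linear_identity n (u, v)" "linear_identity n (p, q)"
    using \<phi> \<psi> by (simp_all add: denotes_def)
  have labels: "label (bracketing_of u) = i" "label (bracketing_of v) = j"
    "label (bracketing_of p) = r" "label (bracketing_of q) = s"
    using \<phi> \<psi> by (simp_all add: denotes_def)
  have lens: "len u = n" "len v = n" "len p = n" "len q = n"
    using lin by (simp_all add: linear_identity_def)
  have dist: "distinct (leaves u)" "distinct (leaves q)"
    using lin by (simp_all add: linear_identity_def)
  have f: "f \<in> carrier (sym_group n)" and g: "g permutes {1..n}"
    using \<phi> \<psi> by (simp_all add: denotes_def sym_group_carrier)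
  \<comment> \<open>Nontriviality of \<psi> enters here and rules out the empty chain.\<close>
  have pq: "p \<noteq> q"
    using assms(6) eqs lin(2) trivial_identity_refl by auto
  show ?thesis
  proof
    assume "implies TYPE('a) \<phi> \<psi>"
    then have con: "(p, q) \<in> connected_by (u, v)"
      using connected_if_implies[OF assms(1) _ lin(1) lens(3,4)] assms(2) eqs by simp
    \<comment> \<open>Otherwise a chain between distinct terms is a single renaming or its reversal,
      and \<phi> and \<psi> would be the same identity.\<close>
    have brk: "bracketing_of u = bracketing_of v"
      using connected_by_different_bracketings[OF lin(1) _ con] pq
        same_identity_renaming[OF lin] assms(7) eqs by auto
    then have ij: "i = j" using labels by simp
    have uv: "permuted_by f u v"
      using denotes_permuted_by[OF \<phi> ij] .
    obtain k :: int where p: "bracketing_of p = bracketing_of u"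
      and k: "permuted_by (f [^]\<^bsub>sym_group n\<^esub> k) p q"
      using connected_by_same_bracketing[OF uv f dist(1) lens(1) con] pq by auto
    have "bracketing_of q = bracketing_of p"
      using k by (simp add: permuted_by_def)
    then have rs: "j = r" "r = s"
      using p ij labels by auto
    have "g = f [^]\<^bsub>sym_group n\<^esub> k"
      using permuted_by_perm_unique[OF denotes_permuted_by[OF \<psi> rs(2)] k dist(2)] g
        sym_group_pow_permutes[OF uv f dist(1) lens(1)] lens(3) by simp
    \<comment> \<open>The power 0 is the identity permutation, which would give
      \<open>p = q\<close>.\<close>
    moreover have "k \<noteq> 0"
    proof
      assume "k = 0"
      then have "permuted_by id p q"
        using k by (simp add: sym_group_one)
      then show False
        using pq permuted_by_right_unique[OF _ permuted_by_id permutes_id] by metis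
    qed
    ultimately show "i = j \<and> j = r \<and> r = s \<and> (\<exists>k::int. k \<noteq> 0 \<and> g = f [^]\<^bsub>sym_group n\<^esub> k)"
      using ij rs by blast
  next
    assume *: "i = j \<and> j = r \<and> r = s \<and> (\<exists>k::int. k \<noteq> 0 \<and> g = f [^]\<^bsub>sym_group n\<^esub> k)"
    then obtain k :: int where k: "g = f [^]\<^bsub>sym_group n\<^esub> k" by blast
    have "bracketing_of p = bracketing_of u"
      using * labels lens by (intro label_inject) auto
    moreover have "permuted_by (f [^]\<^bsub>sym_group n\<^esub> k) p q"
      using denotes_permuted_by[OF \<psi>] * k by simp
    moreover have "permuted_by f u v"
      using denotes_permuted_by[OF \<phi>] * by simp
    ultimately have "(p, q) \<in> connected_by (u, v)"
      using connected_if_permuted_by_pow f dist(1) lens(1) by blast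
    then show "implies TYPE('a) \<phi> \<psi>"
      unfolding implies_def eqs using satisfies_connected by blast
  qed
qed

end
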